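(* Let $S$ be an affine semigroup minimally generated by $\mathcal{A}=\{\mathbf{a}_1,\ldots,\mathbf{a}_p\}\subset\mathbb{N}^r$ ($p$ distinct elements). If $\mathrm{Betti}(S)=\{\mathbf{d}\}$, then $$\rho(S)=\frac{\max(\mathsf{L}(\mathbf{d}))}{\min(\mathsf{L}(\mathbf{d}))}.$$
   Context: $\mathbb{N}$ denotes the nonnegative integers. An affine semigroup is a finitely generated submonoid of $\mathbb{N}^r$ for some positive integer $r$. $S$ is minimally generated by $\mathcal{A}$ if $S=\mathbb{N}\mathbf{a}_1+\cdots+\mathbb{N}\mathbf{a}_p$ and no proper subset of $\mathcal{A}$ generates $S$. The factorization homomorphism is $\pi_\mathcal{A}:\mathbb{N}^p\to S$, $\mathbf{u}=(u_1,\ldots,u_p)\mapsto\sum_{i=1}^p u_i\mathbf{a}_i$; for $\mathbf{a}\in S$, $\mathsf{Z}(\mathbf{a})=\pi_\mathcal{A}^{-1}(\mathbf{a})$ is its set of factorizations. The kernel congruence $\equiv_\mathcal{A}$ is the set of pairs $(\mathbf{u},\mathbf{v})\in\mathbb{N}^p\times\mathbb{N}^p$ with $\pi_\mathcal{A}(\mathbf{u})=\pi_\mathcal{A}(\mathbf{v})$. A presentation of $S$ is a set $\sigma\subseteq\mathbb{N}^p\times\mathbb{N}^p$ such that $\equiv_\mathcal{A}$ is the least congruence on $\mathbb{N}^p$ containing $\sigma$; it is minimal if no proper subset of it generates $\equiv_\mathcal{A}$ as a congruence. $\mathrm{Betti}(S)=\{\pi_\mathcal{A}(\mathbf{u})\mid(\mathbf{u},\mathbf{v})\in\sigma\}$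 for a minimal presentation $\sigma$ of $S$; this set is known not to depend on the choice of $\sigma$. For $\mathbf{u}=(u_1,\ldots,u_p)\in\mathbb{N}^p$, $|\mathbf{u}|=u_1+\cdots+u_p$. The set of lengths of $\mathbf{a}\in S$ is $\mathsf{L}(\mathbf{a})=\{|\mathbf{u}|:\mathbf{u}\in\mathsf{Z}(\mathbf{a})\}$ (a finite set). The elasticity of $\mathbf{a}\in S\setminus\{0\}$ is $\rho(\mathbf{a})=\max(\mathsf{L}(\mathbf{a}))/\min(\mathsf{L}(\mathbf{a}))$, and the elasticity of $S$ is $\rho(S)=\sup\{\rho(\mathbf{a})\mid\mathbf{a}\in S\setminus\{0\}\}$. *)

theory Defs
  imports "HOL-Analysis.Analysis"
begin

text \<open>
  The monoids $\mathbb{N}^r$ and $\mathbb{N}^p$ are \<open>nat ^ 'r\<close> and \<open>nat ^ 'p\<close>. The generators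
  $\mathbf{a}_1, \ldots, \mathbf{a}_p$ are a family \<open>a\<close> indexed by the finite type \<open>'p\<close>.
\<close>

text \<open>
  $\mathbb{N}\mathbf{a}_1 + \cdots + \mathbb{N}\mathbf{a}_p$, meaningful for finite \<open>A\<close> only.
\<close>
definition nat_span :: "(nat ^ 'r) set \<Rightarrow> (nat ^ 'r) set" where
  "nat_span A = {\<Sum>x\<in>A. c x *s x | c. True}"

definition affine_semigroup :: "(nat ^ 'r) set \<Rightarrow> bool" where
  "affine_semigroup S \<longleftrightarrow> (\<exists>A. finite A \<and> S = nat_span A)"

definition minimally_generates :: "(nat ^ 'r) set \<Rightarrow> (nat ^ 'r) set \<Rightarrow> bool" where
  "minimally_generates A S \<longleftrightarrow> finite A \<and> S = nat_span A \<and> (\<forall>B. B \<subset> A \<longrightarrow> nat_span B \<noteq> S)"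

definition factor_hom :: "('p::finite \<Rightarrow> nat ^ 'r) \<Rightarrow> nat ^ 'p \<Rightarrow> nat ^ 'r" where
  "factor_hom a u = (\<Sum>i\<in>UNIV. (u $ i) *s a i)"

definition factorizations :: "('p::finite \<Rightarrow> nat ^ 'r) \<Rightarrow> nat ^ 'r \<Rightarrow> (nat ^ 'p) set" where
  "factorizations a x = factor_hom a -` {x}"

definition kernel_congruence :: "('p::finite \<Rightarrow> nat ^ 'r) \<Rightarrow> (nat ^ 'p) rel" where
  "kernel_congruence a = {(u, v). factor_hom a u = factor_hom a v}"

definition monoid_congruence :: "'m::comm_monoid_add rel \<Rightarrow> bool" where
  "monoid_congruence R \<longleftrightarrow> equiv UNIV R \<and> (\<forall>u v w. (u, v) \<in> R \<longrightarrow> (u + w, v + w) \<in> R)"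

definition generated_congruence :: "'m::comm_monoid_add rel \<Rightarrow> 'm rel" where
  "generated_congruence \<sigma> = monoid_congruence hull \<sigma>"

definition presentation :: "('p::finite \<Rightarrow> nat ^ 'r) \<Rightarrow> (nat ^ 'p) rel \<Rightarrow> bool" where
  "presentation a \<sigma> \<longleftrightarrow> generated_congruence \<sigma> = kernel_congruence a"

definition minimal_presentation :: "('p::finite \<Rightarrow> nat ^ 'r) \<Rightarrow> (nat ^ 'p) rel \<Rightarrow> bool" where
  "minimal_presentation a \<sigma> \<longleftrightarrow> presentation a \<sigma> \<and> (\<forall>\<tau>. \<tau> \<subset> \<sigma> \<longrightarrow> \<not> presentation a \<tau>)"

text \<open>
  The set of Betti elements, read off from a presentation \<open>\<sigma>\<close>. It is the same set for every
  minimal presentation \<open>\<sigma>\<close>; keeping \<open>\<sigma>\<close> as an argument avoids building a choice of \<open>\<sigma>\<close>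
  into the definition.
\<close>
definition Betti :: "('p::finite \<Rightarrow> nat ^ 'r) \<Rightarrow> (nat ^ 'p) rel \<Rightarrow> (nat ^ 'r) set" where
  "Betti a \<sigma> = {factor_hom a u | u v. (u, v) \<in> \<sigma>}"

definition vec_length :: "nat ^ 'p \<Rightarrow> nat" where
  "vec_length u = (\<Sum>i\<in>UNIV. u $ i)"

definition lengths :: "('p::finite \<Rightarrow> nat ^ 'r) \<Rightarrow> nat ^ 'r \<Rightarrow> nat set" where
  "lengths a x = vec_length ` factorizations a x"

definition elasticity :: "('p::finite \<Rightarrow> nat ^ 'r) \<Rightarrow> nat ^ 'r \<Rightarrow> real" where
  "elasticity a x = real (Max (lengths a x)) / real (Min (lengths a x))"

text \<open>
  The supremum is taken in the extended reals, since on \<^typ>\<open>real\<close> it would be unspecified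
  for an unbounded set.
\<close>
definition semigroup_elasticity :: "('p::finite \<Rightarrow> nat ^ 'r) \<Rightarrow> (nat ^ 'r) set \<Rightarrow> ereal" where
  "semigroup_elasticity a S = (SUP x\<in>S - {0}. ereal (elasticity a x))"

end

theory Submission
  imports Defs
begin

text \<open>
  Relating distinct \<open>u\<close> and \<open>v\<close> whenever both dominate some factorization of \<open>d\<close> gives a
  congruence, and it contains every presentation whose only Betti element is \<open>d\<close>. So two distinct
  factorizations \<open>u\<close>, \<open>v\<close> of the same element split as \<open>u = z + u'\<close>, \<open>v = z' + v'\<close> with \<open>z\<close>, \<open>z'\<close>
  factorizations of \<open>d\<close>. Then \<open>u'\<close>, \<open>v'\<close> are again factorizations of a common element, and
  induction on the length of \<open>u\<close> gives \<open>min L(d) * |u| \<le> max L(d) * |v|\<close>.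
\<close>

lemma factor_hom_nth: "factor_hom a u $ j = (\<Sum>i\<in>UNIV. u $ i * a i $ j)"
  by (simp add: factor_hom_def)

lemma factor_hom_add: "factor_hom a (u + v) = factor_hom a u + factor_hom a v"
  by (simp add: vec_eq_iff factor_hom_nth distrib_right sum.distrib)

lemma vec_length_add: "vec_length (u + v) = vec_length u + vec_length v"
  by (simp add: vec_length_def sum.distrib)

lemma vec_length_eq_0_iff: "vec_length u = 0 \<longleftrightarrow> u = 0"
  by (simp add: vec_length_def vec_eq_iff)

lemma factor_hom_0: "factor_hom a 0 = 0"
  by (simp add: vec_eq_iff factor_hom_nth)

text \<open>Deleting \<open>0\<close> leaves the span unchanged, so minimality excludes it. Nonzero
  generators are what later bound the lengths of factorizations.\<close>

lemma minimally_generates_nonzero: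
  assumes "minimally_generates A S"
  shows "0 \<notin> A"
proof
  assume "0 \<in> A"
  have "finite A" using assms by (simp add: minimally_generates_def)
  then have "(\<Sum>x\<in>A - {0}. c x *s x) = (\<Sum>x\<in>A. c x *s x)" for c
    by (intro sum.mono_neutral_left) (auto simp: vec_eq_iff)
  then have "nat_span (A - {0}) = nat_span A"
    by (simp add: nat_span_def)
  moreover have "A - {0} \<subset> A" using \<open>0 \<in> A\<close> by blast
  ultimately show False using assms unfolding minimally_generates_def by blast
qed

text \<open>Coefficients in \<open>nat_span\<close> are indexed by generators, those of
  \<open>factor_hom\<close> by positions; for injective \<open>a\<close>, \<open>inv a\<close>
  translates between the two.\<close>

lemma factor_hom_mem_nat_span:
  assumes "inj a"
  shows "factor_hom a u \<in> nat_span (range a)"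
proof -
  have "factor_hom a u = (\<Sum>x\<in>range a. (u $ inv a x) *s x)"
    using assms by (simp add: factor_hom_def sum.reindex)
  then show ?thesis unfolding nat_span_def by (intro CollectI exI conjI TrueI)
qed

lemma nat_span_range_factor_hom:
  assumes "inj a" "x \<in> nat_span (range a)"
  shows "\<exists>u. factor_hom a u = x"
proof -
  from assms(2) obtain c where "x = (\<Sum>y\<in>range a. c y *s y)"
    unfolding nat_span_def by blast
  then have "factor_hom a (\<chi> i. c (a i)) = x"
    using assms(1) by (simp add: factor_hom_def sum.reindex)
  then show ?thesis ..
qed

text \<open>Each generator is nonzero, so its coordinates add up to at least 1. The bound depends
  only on the factored element, hence its set of lengths is finite and \<open>Max\<close> and
  \<open>Min\<close> are meaningful.\<close>

lemma vec_length_le_factor_hom: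
  fixes a :: "'p::finite \<Rightarrow> nat ^ 'r::finite"
  assumes "0 \<notin> range a"
  shows "vec_length u \<le> (\<Sum>j\<in>UNIV. factor_hom a u $ j)"
proof -
  have pos: "(\<Sum>j\<in>UNIV. a i $ j) \<ge> 1" for i
  proof -
    have "a i \<noteq> 0" using assms by (metis rangeI)
    then have "vec_length (a i) \<ge> 1" using vec_length_eq_0_iff[of "a i"] by linarith
    then show ?thesis by (simp only: vec_length_def)
  qed
  have "vec_length u \<le> (\<Sum>i\<in>UNIV. u $ i * (\<Sum>j\<in>UNIV. a i $ j))"
    unfolding vec_length_def by (rule sum_mono) (use pos in \<open>metis mult.right_neutral mult_le_mono2\<close>)
  also have "\<dots> = (\<Sum>j\<in>UNIV. factor_hom a u $ j)"
    unfolding factor_hom_nth sum_distrib_left by (rule sum.swap)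
  finally show ?thesis .
qed

lemma factor_hom_eq_0_iff:
  fixes a :: "'p::finite \<Rightarrow> nat ^ 'r::finite"
  assumes "0 \<notin> range a"
  shows "factor_hom a u = 0 \<longleftrightarrow> u = 0"
  using vec_length_le_factor_hom[OF assms, of u]
  by (auto simp: factor_hom_0 vec_length_eq_0_iff)

lemma finite_lengths:
  fixes a :: "'p::finite \<Rightarrow> nat ^ 'r::finite"
  assumes "0 \<notin> range a"
  shows "finite (lengths a x)"
proof (rule finite_subset)
  show "lengths a x \<subseteq> {.. \<Sum>j\<in>UNIV. x $ j}"
    using vec_length_le_factor_hom[OF assms]
    by (auto simp: lengths_def factorizations_def)
qed simp

lemma lengths_iff: "n \<in> lengths a x \<longleftrightarrow> (\<exists>u. factor_hom a u = x \<and> vec_length u = n)"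
  by (auto simp: lengths_def factorizations_def)

lemma zero_notin_lengths:
  assumes "x \<noteq> 0"
  shows "0 \<notin> lengths a x"
  using assms by (auto simp: lengths_iff vec_length_eq_0_iff factor_hom_0)

text \<open>The elements dominating a member of \<open>D\<close> form an ideal, and this is its Rees
  congruence, which collapses the ideal to one class. An added \<open>w\<close> is absorbed into the
  cofactors \<open>u'\<close> and \<open>v'\<close>.\<close>

lemma monoid_congruence_domination:
  "monoid_congruence {(u, v). u = v \<or> (\<exists>z\<in>D. \<exists>u'. u = z + u') \<and> (\<exists>z\<in>D. \<exists>v'. v = z + v')}"
  unfolding monoid_congruence_def equiv_def refl_on_def sym_def trans_def
  by (auto; metis add.assoc)

lemma presentation_subset_kernel:
  assumes "presentation a \<sigma>"
  shows "\<sigma> \<subseteq> kernel_congruence a"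
  using assms hull_subset unfolding presentation_def generated_congruence_def by metis

text \<open>\<open>Betti\<close> records first components only; the second follows because related
  pairs lie in the kernel congruence.\<close>

lemma presentation_Betti_factorizations:
  assumes "presentation a \<sigma>" "Betti a \<sigma> = {d}" "(u, v) \<in> \<sigma>"
  shows "factor_hom a u = d" "factor_hom a v = d"
proof -
  show "factor_hom a u = d" using assms(2,3) unfolding Betti_def by blast
  then show "factor_hom a v = d"
    using presentation_subset_kernel[OF assms(1)] assms(3) by (auto simp: kernel_congruence_def)
qed

lemma Betti_singleton_factor_hom:
  assumes "Betti a \<sigma> = {d}"
  shows "\<exists>u. factor_hom a u = d"
  using assms unfolding Betti_def by blast

lemma unique_Betti_split:
  assumes "presentation a \<sigma>" "Betti a \<sigma> = {d}"
    and "factor_hom a u = factor_hom a v" "u \<noteq> v"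
  obtains z u' z' v' where "u = z + u'" "v = z' + v'" "factor_hom a z = d" "factor_hom a z' = d"
proof -
  let ?D = "factorizations a d"
  let ?R = "{(u, v). u = v \<or> (\<exists>z\<in>?D. \<exists>u'. u = z + u') \<and> (\<exists>z\<in>?D. \<exists>v'. v = z + v')}"
  have "\<sigma> \<subseteq> ?R"
  proof (rule subrelI)
    fix s t assume "(s, t) \<in> \<sigma>"
    then have "s \<in> ?D" "t \<in> ?D"
      using presentation_Betti_factorizations[OF assms(1,2)] by (auto simp: factorizations_def)
    \<comment> \<open>A factorization of \<open>d\<close> dominates itself, with cofactor
      \<open>0\<close>.\<close>
    then show "(s, t) \<in> ?R"
      by (simp, metis add.right_neutral)
  qed
  then have "generated_congruence \<sigma> \<subseteq> ?R"
    unfolding generated_congruence_def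
    using monoid_congruence_domination by (rule hull_minimal)
  then have "kernel_congruence a \<subseteq> ?R" using assms(1) by (simp add: presentation_def)
  moreover have "(u, v) \<in> kernel_congruence a"
    using assms(3) by (simp add: kernel_congruence_def)
  ultimately have "(u, v) \<in> ?R" by blast
  then show thesis using assms(4) that by (auto simp: factorizations_def)
qed

text \<open>The only factorization of \<open>0\<close> is \<open>0\<close>, so \<open>d = 0\<close>
  would force the presentation to be \<open>{(0, 0)}\<close>. That pair is redundant, contradicting
  minimality.\<close>

lemma Betti_nonzero:
  fixes a :: "'p::finite \<Rightarrow> nat ^ 'r::finite"
  assumes "0 \<notin> range a" "minimal_presentation a \<sigma>" "Betti a \<sigma> = {d}"
  shows "d \<noteq> 0"
proof
  assume "d = 0"
  have pres: "presentation a \<sigma>" using assms(2) by (simp add: minimal_presentation_def)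
  have sub: "\<sigma> \<subseteq> {(0, 0)}"
    using presentation_Betti_factorizations[OF pres assms(3)] \<open>d = 0\<close>
    by (auto simp: factor_hom_eq_0_iff[OF assms(1)])
  have "generated_congruence \<sigma> = generated_congruence {}"
  proof -
    \<comment> \<open>Reflexivity puts \<open>(0, 0)\<close> into every congruence, so
      \<open>\<sigma>\<close> and \<open>{}\<close> have the same hull.\<close>
    have "\<sigma> \<subseteq> R" if "monoid_congruence R" for R
      using that sub by (auto simp: monoid_congruence_def equiv_def refl_on_def)
    then show ?thesis unfolding generated_congruence_def hull_def
      by (metis (no_types, lifting) empty_subsetI)
  qed
  then have "presentation a {}" using pres by (simp add: presentation_def)
  moreover have "\<sigma> \<noteq> {}" using assms(3) by (auto simp: Betti_def)
  ultimately show False using assms(2) by (auto simp: minimal_presentation_def)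
qed

text \<open>The comparison of ratios is cross-multiplied: it stays in the naturals and also makes
  sense for \<open>u = v = 0\<close>, which the induction can reach.\<close>

lemma unique_Betti_length_bound:
  fixes a :: "'p::finite \<Rightarrow> nat ^ 'r::finite"
  assumes nz: "0 \<notin> range a" and pres: "presentation a \<sigma>" "Betti a \<sigma> = {d}" and "d \<noteq> 0"
    and "factor_hom a u = factor_hom a v"
  shows "Min (lengths a d) * vec_length u \<le> Max (lengths a d) * vec_length v"
  using assms(5)
proof (induction "vec_length u" arbitrary: u v rule: less_induct)
  case less
  let ?m = "Min (lengths a d)" and ?M = "Max (lengths a d)"
  note fin = finite_lengths[OF nz, of d]
  show ?case
  proof (cases "u = v")
    case True
    have "lengths a d \<noteq> {}"
      using Betti_singleton_factor_hom[OF pres(2)] by (auto simp: lengths_def factorizations_def)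
    then have "?m \<le> ?M" using fin by simp
    then show ?thesis using True by simp
  next
    case False
    obtain z u' z' v' where s: "u = z + u'" "v = z' + v'" "factor_hom a z = d" "factor_hom a z' = d"
      using unique_Betti_split[OF pres less.prems False] .
    \<comment> \<open>This makes \<open>u'\<close> strictly shorter than \<open>u\<close>, so the
      induction hypothesis applies.\<close>
    have "vec_length z \<noteq> 0"
      using s(3) \<open>d \<noteq> 0\<close> by (auto simp: vec_length_eq_0_iff factor_hom_0)
    moreover have "factor_hom a u' = factor_hom a v'"
      using less.prems s by (simp add: factor_hom_add)
    ultimately have "?m * vec_length u' \<le> ?M * vec_length v'"
      by (intro less.hyps) (simp_all add: s(1) vec_length_add)
    \<comment> \<open>Both products are compared with \<open>?m * ?M\<close>.\<close>
    moreover have "?m * vec_length z \<le> ?M * vec_length z'"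
    proof -
      have "vec_length z \<le> ?M" "?m \<le> vec_length z'"
        using fin s(3,4) by (auto intro!: Max_ge Min_le simp: lengths_iff)
      then show ?thesis by (metis mult.commute mult_le_mono)
    qed
    ultimately show ?thesis by (simp add: s vec_length_add distrib_left)
  qed
qed

theorem corollary15:
  fixes a :: "'p::finite \<Rightarrow> nat ^ 'r::finite"
    and S :: "(nat ^ 'r) set"
    and d :: "nat ^ 'r"
    and \<sigma> :: "(nat ^ 'p) rel"
  assumes "affine_semigroup S"
    and "inj a"
    and "minimally_generates (range a) S"
    and "minimal_presentation a \<sigma>"
    and "Betti a \<sigma> = {d}"
  shows "semigroup_elasticity a S
    = ereal (real (Max (lengths a d)) / real (Min (lengths a d)))"
proof -
  note nz = minimally_generates_nonzero[OF assms(3)]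
  note fin = finite_lengths[OF nz]
  have pres: "presentation a \<sigma>" using assms(4) by (simp add: minimal_presentation_def)
  have S: "S = nat_span (range a)" using assms(3) by (simp add: minimally_generates_def)
  have "d \<noteq> 0" using Betti_nonzero[OF nz assms(4,5)] .
  have "d \<in> S"
    using Betti_singleton_factor_hom[OF assms(5)] factor_hom_mem_nat_span[OF assms(2)]
    unfolding S by metis
  have ne: "lengths a x \<noteq> {}" if "x \<in> S" for x
    using nat_span_range_factor_hom[OF assms(2), of x] that
    by (auto simp: S lengths_def factorizations_def)
  have min_pos: "Min (lengths a x) > 0" if "x \<in> S" "x \<noteq> 0" for x
    using Min_in[OF fin ne[OF that(1)]] zero_notin_lengths[OF that(2), of a] by (metis gr0I)
  have "elasticity a x \<le> elasticity a d" if x: "x \<in> S" "x \<noteq> 0" for x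
  proof -
    \<comment> \<open>The length bound is applied to a longest factorization \<open>u\<close> and a
      shortest factorization \<open>v\<close> of \<open>x\<close>.\<close>
    obtain u v where "factor_hom a u = x" "vec_length u = Max (lengths a x)"
      "factor_hom a v = x" "vec_length v = Min (lengths a x)"
      using Max_in[OF fin ne[OF x(1)]] Min_in[OF fin ne[OF x(1)]] by (auto simp: lengths_iff)
    then have "Min (lengths a d) * Max (lengths a x) \<le> Max (lengths a d) * Min (lengths a x)"
      using unique_Betti_length_bound[OF nz pres assms(5) \<open>d \<noteq> 0\<close>, of u v] by simp
    then have "real (Min (lengths a d)) * real (Max (lengths a x))
        \<le> real (Max (lengths a d)) * real (Min (lengths a x))"
      by (metis of_nat_le_iff of_nat_mult)
    then show ?thesis
      using min_pos[OF x] min_pos[OF \<open>d \<in> S\<close> \<open>d \<noteq> 0\<close>]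
      by (simp add: elasticity_def divide_simps mult.commute)
  qed
  \<comment> \<open>Since \<open>d\<close> is itself a nonzero element of \<open>S\<close>, the
    upper bound is attained and equals the supremum.\<close>
  then have "semigroup_elasticity a S = ereal (elasticity a d)"
    unfolding semigroup_elasticity_def
    using \<open>d \<in> S\<close> \<open>d \<noteq> 0\<close> by (intro antisym SUP_least SUP_upper) auto
  then show ?thesis by (simp add: elasticity_def)
qed

end
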